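(* For every integer $r\ge 1$ and every $j\in\{0,1,\ldots,r\}$, $$\sum_{k=0}^{r}\frac{1}{2j+2k+1}\left(\sum_{m=0}^{2j+2k}\binom{2j+2k+1}{m}\left((r+1)^{2j+2k+1-m}-1\right)\sum_{\ell=0}^{m}\frac{(-1)^{\ell}\,\ell!}{\ell+1}S(m,\ell)\right)\left(\sum_{i=0}^{2k+2}(-1)^{r+1+i}s(r+1,i)\,s(r+1,2k+2-i)\right)=0.$$
   Context: $s(n,k)$ denotes the (signed) Stirling numbers of the first kind, i.e. $x(x-1)\cdots(x-n+1)=\sum_{k=0}^{n}s(n,k)x^k$, with $s(n,k)=0$ for $k>n$. $S(n,k)$ denotes the Stirling numbers of the second kind, i.e. the number of partitions of an $n$-element set into $k$ nonempty blocks, with $S(0,0)=1$. *)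

theory Defs
  imports
    Complex_Main
    "HOL-Combinatorics.Stirling"
    "HOL-Library.Disjoint_Sets"
    "HOL-Computational_Algebra.Polynomial"
begin

section \<open>Signed Stirling numbers of the first kind\<close>

text \<open>
  The library's \<^const>\<open>stirling\<close> is the unsigned number (the number of permutations of \<open>n\<close> points
  with \<open>k\<close> cycles); the signed number is the coefficient of \<open>x\<^sup>k\<close> in \<open>x (x - 1) \<dots> (x - n + 1)\<close>.
\<close>

definition signed_stirling :: "nat \<Rightarrow> nat \<Rightarrow> int" where
  "signed_stirling n k = coeff (\<Prod>i<n. [:- int i, 1:]) k"

lemma degree_falling_factorial: "degree (\<Prod>i<n. [:- int i, 1:]) = n"
  by (subst degree_prod_eq_sum_degree) auto

lemma signed_stirling_expansion:
  "(\<Prod>i<n. x - int i) = (\<Sum>k\<le>n. signed_stirling n k * x ^ k)"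
proof -
  have "(\<Prod>i<n. x - int i) = poly (\<Prod>i<n. [:- int i, 1:]) x"
    by (simp add: poly_prod)
  also have "\<dots> = (\<Sum>k\<le>n. signed_stirling n k * x ^ k)"
    by (simp only: poly_altdef degree_falling_factorial signed_stirling_def)
  finally show ?thesis .
qed

lemma signed_stirling_less: "n < k \<Longrightarrow> signed_stirling n k = 0"
  unfolding signed_stirling_def by (rule coeff_eq_0) (simp add: degree_falling_factorial)

lemma signed_stirling_eq_stirling: "signed_stirling n k = (- 1) ^ (n + k) * int (stirling n k)"
proof (induction n arbitrary: k)
  case 0
  then show ?case by (cases k) (auto simp: signed_stirling_def)
next
  case (Suc n)
  have rec: "signed_stirling (Suc n) k
    = (if k = 0 then 0 else signed_stirling n (k - 1)) - int n * signed_stirling n k"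
    by (cases k) (simp_all add: signed_stirling_def mult.commute[of "prod _ _"])
  show ?case
  proof (cases k)
    case 0
    then show ?thesis unfolding rec Suc.IH by (cases n) simp_all
  next
    case (Suc k')
    then show ?thesis unfolding rec Suc.IH by (simp add: algebra_simps)
  qed
qed

section \<open>Stirling numbers of the second kind\<close>

text \<open>
  The library defines \<^const>\<open>Stirling\<close> by its recurrence; this is the set-partition count.
\<close>

lemma card_partition_on_eq_Stirling:
  assumes "finite A"
  shows "card {P. partition_on A P \<and> card P = k} = Stirling (card A) k"
  using assms
proof (induction A arbitrary: k rule: finite_induct)
  case empty
  have "{P. partition_on ({} :: 'a set) P \<and> card P = k} = (if k = 0 then {{}} else {})"
    by (auto simp: partition_on_empty)
  then show ?case by (cases k) (simp_all only: card.empty, simp_all)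
next
  case (insert a A)
  define X where "X k = {P. partition_on A P \<and> card P = k}" for k
  have finX: "finite (X k)" for k
    unfolding X_def using finitely_many_partition_on[OF insert.hyps(1)] by (rule rev_finite_subset) auto
  have noa: "a \<notin> B" if "P \<in> X k" "B \<in> P" for P B k
    using that insert.hyps by (auto simp: X_def partition_on_def)
  have finP: "finite P" if "P \<in> X k" for P k
    using that finite_elements[OF insert.hyps(1)] by (auto simp: X_def)
  show ?case
  proof (cases k)
    case 0
    have "\<not> (partition_on (insert a A) P \<and> card P = 0)" for P
    proof
      assume P: "partition_on (insert a A) P \<and> card P = 0"
      then have "finite P" using finite_elements insert.hyps(1) finite.insertI by metis
      with P have "P = {}" by auto
      with P show False by (auto simp: partition_on_def)
    qed
    then have "{P. partition_on (insert a A) P \<and> card P = k} = {}" using 0 by blast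
    then show ?thesis using insert.hyps 0 by (simp only: card.empty) simp
  next
    case (Suc k')
    define g where "g = (\<lambda>(P, B). insert (insert a B) (P - {B}))"
    define Y where "Y = insert {a} ` X k'"
    define Z where "Z = g ` (SIGMA P:X k. P)"
    have eq: "{P. partition_on (insert a A) P \<and> card P = k} = Y \<union> Z"
    proof (intro equalityI subsetI)
      fix P assume "P \<in> {P. partition_on (insert a A) P \<and> card P = k}"
      then have P: "partition_on (insert a A) P" "card P = k" by auto
      have fP: "finite P" using P(1) insert.hyps(1) finite_elements finite.insertI by metis
      obtain C where C: "C \<in> P" "a \<in> C" using P(1) by (auto simp: partition_on_def)
      have other: "a \<notin> D" if "D \<in> P" "D \<noteq> C" for D
        using P(1) that C by (auto simp: partition_on_def disjoint_def)
      show "P \<in> Y \<union> Z"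
      proof (cases "C = {a}")
        case True
        have "\<Union>P = insert a A" using P(1) by (simp add: partition_on_def)
        moreover have "\<Union>P = insert a (\<Union>(P - {C}))" using C True by blast
        moreover have "a \<notin> \<Union>(P - {C})" using other by blast
        ultimately have "\<Union>(P - {C}) = A" using insert.hyps(2) insert_ident by metis
        then have "partition_on A (P - {C})"
          using P(1) by (auto simp: partition_on_def disjoint_def)
        moreover have "card (P - {C}) = k'" using C fP P(2) Suc by simp
        ultimately have "P - {C} \<in> X k'" by (auto simp: X_def)
        moreover have "P = insert {a} (P - {C})" using C True by auto
        ultimately show ?thesis unfolding Y_def by blast
      next
        case False
        define B where "B = C - {a}"
        define Q where "Q = insert B (P - {C})"
        have CB: "C = insert a B" using C by (auto simp: B_def)
        have Bne: "B \<noteq> {}" using False C by (auto simp: B_def)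
        have BP: "B \<notin> P"
        proof
          assume "B \<in> P"
          moreover have "B \<noteq> C" using C by (auto simp: B_def)
          ultimately have "B \<inter> C = {}"
            using P(1) C by (auto simp: partition_on_def disjoint_def)
          then show False using Bne by (auto simp: B_def)
        qed
        have U: "\<Union>P = insert a A" and dj: "disjoint P" and ne: "{} \<notin> P"
          using P(1) by (auto simp: partition_on_def)
        have dC: "D \<inter> C = {}" if "D \<in> P" "D \<noteq> C" for D
          using dj that C by (auto simp: disjoint_def)
        have "\<Union>P = insert a (\<Union>Q)" using C by (auto simp: Q_def B_def)
        moreover have "a \<notin> \<Union>Q" using other by (auto simp: Q_def B_def)
        ultimately have "\<Union>Q = A" using U insert.hyps(2) insert_ident by metis
        moreover have "disjoint Q"
          unfolding Q_def disjoint_def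
        proof (intro ballI impI)
          fix D E assume "D \<in> insert B (P - {C})" "E \<in> insert B (P - {C})" "D \<noteq> E"
          then show "D \<inter> E = {}"
            using dj dC by (auto simp: disjoint_def B_def)
        qed
        moreover have "{} \<notin> Q" using ne Bne by (auto simp: Q_def)
        ultimately have "partition_on A Q" by (auto simp: partition_on_def)
        moreover have "card Q = k" using C fP BP P(2) Suc by (simp add: Q_def)
        ultimately have "Q \<in> X k" by (auto simp: X_def)
        moreover have "P = g (Q, B)" using CB C BP by (auto simp: g_def Q_def)
        moreover have "B \<in> Q" by (simp add: Q_def)
        ultimately show ?thesis unfolding Z_def by blast
      qed
    next
      fix P assume "P \<in> Y \<union> Z"
      then show "P \<in> {P. partition_on (insert a A) P \<and> card P = k}"
      proof
        assume "P \<in> Y"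
        then obtain Q where Q: "Q \<in> X k'" "P = insert {a} Q" by (auto simp: Y_def)
        have "{a} \<notin> Q" using noa[OF Q(1)] by blast
        then have "card P = k" using Q finP[OF Q(1)] Suc by (auto simp: X_def)
        moreover have "partition_on (insert a A) P"
          using Q noa[OF Q(1)] by (auto simp: X_def partition_on_def disjoint_def)
        ultimately show ?thesis by simp
      next
        assume "P \<in> Z"
        then obtain Q B where Q: "Q \<in> X k" "B \<in> Q" "P = insert (insert a B) (Q - {B})"
          by (auto simp: Z_def g_def)
        have "insert a B \<notin> Q" using noa[OF Q(1)] by blast
        then have "card P = k" using Q finP[OF Q(1)] Suc by (auto simp: X_def)
        moreover have "partition_on (insert a A) P"
        proof -
          have U: "\<Union>Q = A" and dj: "disjoint Q" and ne: "{} \<notin> Q"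
            using Q(1) by (auto simp: X_def partition_on_def)
          have "\<Union>P = insert a A" using U Q by blast
          moreover have "disjoint P"
            unfolding Q(3) disjoint_def
          proof (intro ballI impI)
            fix D E assume "D \<in> insert (insert a B) (Q - {B})" "E \<in> insert (insert a B) (Q - {B})"
              "D \<noteq> E"
            then show "D \<inter> E = {}"
              using dj Q(2) noa[OF Q(1)] by (auto simp: disjoint_def)
          qed
          moreover have "{} \<notin> P" using ne Q by auto
          ultimately show ?thesis by (auto simp: partition_on_def)
        qed
        ultimately show ?thesis by simp
      qed
    qed
    have disj: "Y \<inter> Z = {}"
    proof -
      have False if Q: "Q \<in> X k'" and R: "R \<in> X k" "B \<in> R"
        and e: "insert {a} Q = insert (insert a B) (R - {B})" for Q R B
      proof -
        have "{a} \<in> insert (insert a B) (R - {B})" using e by blast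
        then have "{a} = insert a B" using noa[OF R(1)] by blast
        then have "B = {}" using noa[OF R] by auto
        then show False using R by (auto simp: X_def partition_on_def)
      qed
      then show ?thesis unfolding Y_def Z_def g_def by fastforce
    qed
    have "inj_on (insert {a}) (X k')"
      by (rule inj_onI) (metis insertI1 noa insert_ident)
    then have cY: "card Y = Stirling (card A) k'"
      unfolding Y_def using insert.IH[of k'] by (simp add: card_image X_def)
    have "inj_on g (SIGMA P:X k. P)"
    proof (rule inj_onI, clarify)
      fix P B Q C
      assume P: "P \<in> X k" "B \<in> P" and Q: "Q \<in> X k" "C \<in> Q" and e: "g (P, B) = g (Q, C)"
      have e': "insert (insert a B) (P - {B}) = insert (insert a C) (Q - {C})"
        using e by (simp add: g_def)
      have "insert a B \<in> insert (insert a C) (Q - {C})" using e' by blast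
      then have "insert a B = insert a C" using noa[OF Q(1)] by blast
      then have BC: "B = C" using noa[OF P] noa[OF Q] by (metis insert_ident)
      have "insert a B \<notin> P - {B}" "insert a B \<notin> Q - {B}"
        using noa[OF P(1)] noa[OF Q(1)] by blast+
      then have "P - {B} = Q - {B}" using e' BC by (metis insert_ident)
      then show "P = Q \<and> B = C" using BC P Q by blast
    qed
    then have "card Z = card (SIGMA P:X k. P)" unfolding Z_def by (rule card_image)
    also have "\<dots> = (\<Sum>P\<in>X k. card P)"
      using finX finP by (intro card_SigmaI) auto
    also have "\<dots> = (\<Sum>P\<in>X k. k)" by (rule sum.cong) (auto simp: X_def)
    also have "\<dots> = k * Stirling (card A) k" using insert.IH[of k] by (simp add: X_def)
    finally have cZ: "card Z = k * Stirling (card A) k" .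
    have "finite Y" unfolding Y_def using finX by simp
    moreover have "finite Z" unfolding Z_def using finX finP by (intro finite_imageI finite_SigmaI) auto
    ultimately have "card (Y \<union> Z) = card Y + card Z" using disj by (rule card_Un_disjoint)
    then show ?thesis using eq cY cZ insert.hyps Suc by simp
  qed
qed

end

theory Submission
  imports Defs
begin

text \<open>
  The innermost sum over \<open>l\<close> is the Bernoulli number \<open>B\<^sub>m\<close> (with \<open>B\<^sub>1 = - 1 / 2\<close>), so by Faulhaber's
  formula the factor in front of the Stirling convolution is the power sum \<open>1\<^sup>2\<^sup>j\<^sup>+\<^sup>2\<^sup>k + \<dots> + r\<^sup>2\<^sup>j\<^sup>+\<^sup>2\<^sup>k\<close>.
  Up to sign, the convolution is the coefficient of \<open>x\<close> to the power \<open>2 k + 2\<close> in \<open>P (- x) P x\<close>, where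
  \<open>P x = x (x - 1) \<dots> (x - r)\<close>. That product is even and vanishes at \<open>0, \<dots>, r\<close>, so exchanging
  the summations gives a sum of zeros.
\<close>

definition bernoulli_number :: "nat \<Rightarrow> real" where
  "bernoulli_number m = (\<Sum>l=0..m. (-1) ^ l * fact l / real (l + 1) * real (Stirling m l))"

text \<open>\<open>Stirling m l\<close> vanishes for \<open>l > m\<close>. A range for
  \<open>l\<close> that is independent of \<open>m\<close> allows sums over \<open>m\<close> and
  \<open>l\<close> to be exchanged.\<close>

lemma bernoulli_number_extend:
  assumes "m \<le> N"
  shows "bernoulli_number m = (\<Sum>l\<le>N. (-1) ^ l * fact l / real (l + 1) * real (Stirling m l))"
  unfolding bernoulli_number_def using assms by (intro sum.mono_neutral_left) auto

lemma sum_binomial_Suc: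
  fixes f :: "nat \<Rightarrow> nat"
  shows "(\<Sum>m\<le>Suc n. (Suc n choose m) * f m) =
    (\<Sum>m\<le>n. (n choose m) * f m) + (\<Sum>m\<le>n. (n choose m) * f (Suc m))"
proof -
  have "(\<Sum>m\<le>Suc n. (Suc n choose m) * f m) =
      f 0 + (\<Sum>m\<le>n. (n choose Suc m) * f (Suc m)) + (\<Sum>m\<le>n. (n choose m) * f (Suc m))"
    by (subst sum.atMost_Suc_shift) (simp add: sum.distrib algebra_simps)
  also have "f 0 + (\<Sum>m\<le>n. (n choose Suc m) * f (Suc m)) = (\<Sum>m\<le>Suc n. (n choose m) * f m)"
    by (subst sum.atMost_Suc_shift) simp
  finally show ?thesis by simp
qed

text \<open>Combinatorially, \<open>m\<close> counts the points outside the block of a distinguished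
  point. The proof is an induction from Pascal's rule and the recurrence of
  \<open>Stirling\<close>.\<close>

lemma sum_binomial_Stirling: "(\<Sum>m\<le>n. (n choose m) * Stirling m l) = Stirling (Suc n) (Suc l)"
proof (induction n arbitrary: l)
  case 0
  then show ?case by (cases l) auto
next
  case (Suc n)
  show ?case
  proof (cases l)
    case 0
    then show ?thesis using Suc.IH[of 0] by (simp only: sum_binomial_Suc) simp
  next
    case (Suc l')
    have "(\<Sum>m\<le>n. (n choose m) * Stirling (Suc m) l) =
        l * (\<Sum>m\<le>n. (n choose m) * Stirling m l) + (\<Sum>m\<le>n. (n choose m) * Stirling m l')"
      by (simp add: Suc sum_distrib_left sum.distrib algebra_simps)
    then show ?thesis
      unfolding sum_binomial_Suc Suc.IH by (simp add: Suc)
  qed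
qed

text \<open>The recurrence of \<open>Stirling\<close> makes the sum telescope; the upper end
  \<open>g (Suc N)\<close> vanishes since \<open>Suc N > n'\<close>, and \<open>g 0\<close> is
  nonzero only for \<open>n' = 0\<close>.\<close>

lemma alternating_sum_Stirling:
  assumes "n \<ge> 1" "n \<le> N"
  shows "(\<Sum>l\<le>N. (-1) ^ l * fact l * real (Stirling n (Suc l))) = (if n = 1 then 1 else 0)"
proof -
  obtain n' where n: "n = Suc n'" using assms by (cases n) auto
  define g where "g l = (-1) ^ l * fact l * real (Stirling n' l)" for l
  have "(\<Sum>l\<le>N. (-1) ^ l * fact l * real (Stirling n (Suc l))) = (\<Sum>l\<le>N. g l - g (Suc l))"
    by (intro sum.cong refl) (simp add: n g_def algebra_simps)
  also have "\<dots> = g 0 - g (Suc N)" by (rule sum_telescope)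
  also have "\<dots> = (if n = 1 then 1 else 0)"
    using assms n by (cases n') (auto simp: g_def)
  finally show ?thesis .
qed

text \<open>Summing over \<open>m\<close> first turns \<open>Stirling m l\<close> into
  \<open>Stirling (Suc n) (Suc l)\<close>. In its recurrence the factor \<open>Suc l\<close> cancels
  the denominator, leaving the alternating sum, and the other term restores
  \<open>bernoulli_number n\<close>, which cancels against the summand \<open>m = n\<close>.\<close>

lemma bernoulli_number_recurrence:
  assumes "n \<ge> 1"
  shows "(\<Sum>m<n. real (n choose m) * bernoulli_number m) = (if n = 1 then 1 else 0)"
proof -
  define a :: "nat \<Rightarrow> real" where "a l = (-1) ^ l * fact l / real (l + 1)" for l
  have a: "a l * real (Suc l) = (-1) ^ l * fact l" for l
    by (simp add: a_def del: of_nat_Suc)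
  have "(\<Sum>m\<le>n. real (n choose m) * bernoulli_number m) =
      (\<Sum>m\<le>n. \<Sum>l\<le>n. a l * real ((n choose m) * Stirling m l))"
    by (intro sum.cong refl)
      (simp add: bernoulli_number_extend[of _ n] sum_distrib_left a_def algebra_simps)
  also have "\<dots> = (\<Sum>l\<le>n. a l * real (\<Sum>m\<le>n. (n choose m) * Stirling m l))"
    by (subst sum.swap) (simp only: sum_distrib_left of_nat_sum)
  also have "\<dots> = (\<Sum>l\<le>n. a l * real (Stirling n l) + (a l * real (Suc l)) * real (Stirling n (Suc l)))"
    by (simp only: sum_binomial_Stirling) (simp add: algebra_simps)
  also have "\<dots> = bernoulli_number n + (if n = 1 then 1 else 0)"
    unfolding sum.distrib a alternating_sum_Stirling[OF assms order_refl]
    by (simp add: bernoulli_number_extend[of n n] a_def)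
  finally show ?thesis by (simp add: lessThan_Suc_atMost[symmetric])
qed

text \<open>After binomial expansion the coefficient of \<open>x ^ q\<close> is
  \<open>n choose q\<close> times the recurrence at \<open>n - q\<close>, so only
  \<open>q = n - 1\<close> survives.\<close>

lemma bernoulli_polynomial_difference:
  fixes x :: real
  assumes "n \<ge> 1"
  shows "(\<Sum>m<n. real (n choose m) * ((x + 1) ^ (n - m) - x ^ (n - m)) * bernoulli_number m) =
    real n * x ^ (n - 1)"
proof -
  have step: "(x + 1) ^ d - x ^ d = (\<Sum>q<d. real (d choose q) * x ^ q)" for d
    by (simp add: binomial_ring lessThan_Suc_atMost[symmetric])
  have "(\<Sum>m<n. real (n choose m) * ((x + 1) ^ (n - m) - x ^ (n - m)) * bernoulli_number m) =
      (\<Sum>m<n. \<Sum>q<n - m. real (n choose m) * real (n - m choose q) * x ^ q * bernoulli_number m)"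
    unfolding step by (simp add: sum_distrib_left sum_distrib_right mult_ac)
  also have "\<dots> = (\<Sum>q<n. \<Sum>m<n - q. real (n choose m) * real (n - m choose q) * x ^ q * bernoulli_number m)"
    \<comment> \<open>Both index sets describe \<open>m + q < n\<close>.\<close>
    unfolding sum.Sigma[OF finite_lessThan ballI[OF finite_lessThan]]
    by (rule sum.reindex_bij_witness[of _ prod.swap prod.swap]) auto
  also have "\<dots> = (\<Sum>q<n. real (n choose q) * x ^ q * (\<Sum>m<n - q. real (n - q choose m) * bernoulli_number m))"
    unfolding sum_distrib_left
  proof (intro sum.cong refl)
    fix q m assume "q \<in> {..<n}" "m \<in> {..<n - q}"
    \<comment> \<open>Both sides are the trinomial coefficient of \<open>m\<close>, \<open>q\<close>
      and \<open>n - m - q\<close>.\<close>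
    then have "(n choose m) * (n - m choose q) = (n choose q) * (n - q choose m)"
      using choose_mult[of m "m + q" n] choose_mult[of q "m + q" n] binomial_symmetric[of m "m + q"]
      by simp
    then have "real (n choose m) * real (n - m choose q) = real (n choose q) * real (n - q choose m)"
      by (simp flip: of_nat_mult)
    then show "real (n choose m) * real (n - m choose q) * x ^ q * bernoulli_number m =
        real (n choose q) * x ^ q * (real (n - q choose m) * bernoulli_number m)"
      by simp
  qed
  also have "\<dots> = (\<Sum>q<n. if q = n - 1 then real n * x ^ (n - 1) else 0)"
  proof (intro sum.cong refl)
    fix q assume "q \<in> {..<n}"
    then show "real (n choose q) * x ^ q * (\<Sum>m<n - q. real (n - q choose m) * bernoulli_number m) =
        (if q = n - 1 then real n * x ^ (n - 1) else 0)"
      using assms binomial_symmetric[of 1 n] by (subst bernoulli_number_recurrence) auto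
  qed
  also have "\<dots> = real n * x ^ (n - 1)" using assms by simp
  finally show ?thesis .
qed

text \<open>The differences at \<open>x = 1, ..., r\<close> telescope; the \<open>1\<close> being
  subtracted is \<open>1 ^ (n - m)\<close>.\<close>

lemma faulhaber:
  assumes "n \<ge> 1"
  shows "(\<Sum>m<n. real (n choose m) * (real (r + 1) ^ (n - m) - 1) * bernoulli_number m) =
    real n * (\<Sum>x=1..r. real x ^ (n - 1))"
proof (induction r)
  case 0
  then show ?case by simp
next
  case (Suc r)
  have "(\<Sum>m<n. real (n choose m) * (real (Suc r + 1) ^ (n - m) - 1) * bernoulli_number m) =
      (\<Sum>m<n. real (n choose m) * ((real (r + 1) + 1) ^ (n - m) - real (r + 1) ^ (n - m)) * bernoulli_number m) +
      (\<Sum>m<n. real (n choose m) * (real (r + 1) ^ (n - m) - 1) * bernoulli_number m)"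
    unfolding sum.distrib[symmetric] by (intro sum.cong refl) (simp add: algebra_simps)
  then show ?case
    unfolding Suc.IH bernoulli_polynomial_difference[OF assms]
    by (simp add: algebra_simps)
qed

lemma coeff_pcompose_uminus:
  fixes p :: "'a::comm_ring_1 poly"
  shows "coeff (pcompose p [:0, -1:]) n = (-1) ^ n * coeff p n"
  using coeff_pcompose_linear[of p "-1" n] by simp

lemma stirling_convolution_root:
  assumes "1 \<le> x" "x \<le> r"
  shows "(\<Sum>k=0..r. (\<Sum>i=0..2*k + 2. (-1) ^ (r + 1 + i) *
      of_int (signed_stirling (r + 1) i) * of_int (signed_stirling (r + 1) (2*k + 2 - i)))
      * real x ^ (2 * k)) = 0"
proof -
  define P where "P = (\<Prod>i<r + 1. [:- int i, 1:])"
  define Q where "Q = pcompose P [:0, -1:] * P"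
  have root: "poly P (int y) = 0" if "y \<le> r" for y
    using that by (auto simp: P_def poly_prod intro!: bexI[of _ y])
  have "degree P = r + 1" unfolding P_def by (rule degree_falling_factorial)
  then have deg: "degree Q \<le> 2 * r + 2"
    unfolding Q_def using degree_mult_le[of "pcompose P [:0, -1:]" P]
      degree_pcompose[of P "[:0, -1:]"] by simp
  have even: "coeff Q n = 0" if "odd n" for n
  proof -
    \<comment> \<open>Replacing \<open>x\<close> by \<open>-x\<close> swaps the two factors of
      \<open>Q\<close>.\<close>
    have "pcompose Q [:0, -1:] = Q"
      by (simp add: Q_def pcompose_mult pcompose_assoc[symmetric] pcompose_pCons mult.commute)
    then have "(-1) ^ n * coeff Q n = coeff Q n" by (metis coeff_pcompose_uminus)
    then show ?thesis using that by simp
  qed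
  have zero: "coeff Q 0 = 0"
    using root[of 0] by (simp add: Q_def coeff_mult poly_0_coeff_0)
  \<comment> \<open>The sign \<open>(-1) ^ i\<close> comes from the factor \<open>P (- x)\<close>;
    \<open>(-1) ^ (r + 1)\<close> is a global sign.\<close>
  have conv: "(\<Sum>i=0..n. (-1) ^ (r + 1 + i) * real_of_int (signed_stirling (r + 1) i) *
      of_int (signed_stirling (r + 1) (n - i))) = (-1) ^ (r + 1) * of_int (coeff Q n)" for n
  proof -
    have s: "signed_stirling (r + 1) i = coeff P i" for i
      by (simp only: signed_stirling_def P_def)
    show ?thesis
      unfolding s Q_def coeff_mult coeff_pcompose_uminus of_int_sum sum_distrib_left atLeast0AtMost
      by (simp add: power_add mult.assoc)
  qed
  have "0 = poly Q (int x)" using root[OF assms(2)] by (simp add: Q_def)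
  also have "\<dots> = (\<Sum>n\<le>2 * r + 2. coeff Q n * int x ^ n)"
    unfolding poly_altdef using deg
    by (intro sum.mono_neutral_left) (auto simp: coeff_eq_0)
  \<comment> \<open>Only positive even exponents contribute.\<close>
  also have "\<dots> = (\<Sum>n\<in>(\<lambda>k. 2 * k + 2) ` {0..r}. coeff Q n * int x ^ n)"
  proof (intro sum.mono_neutral_right ballI)
    fix n assume n: "n \<in> {..2 * r + 2} - (\<lambda>k. 2 * k + 2) ` {0..r}"
    have "odd n \<or> n = 0"
    proof (rule ccontr)
      assume "\<not> (odd n \<or> n = 0)"
      then obtain k where "n = 2 * Suc k" by (metis evenE mult_0_right not0_implies_Suc)
      then show False using n by auto
    qed
    then show "coeff Q n * int x ^ n = 0" using even zero by auto
  qed auto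
  also have "\<dots> = (\<Sum>k=0..r. coeff Q (2 * k + 2) * int x ^ (2 * k + 2))"
    by (subst sum.reindex) (auto simp: inj_on_def)
  also have "\<dots> = int x ^ 2 * (\<Sum>k=0..r. coeff Q (2 * k + 2) * int x ^ (2 * k))"
    by (simp add: sum_distrib_left power_add algebra_simps power2_eq_square)
  \<comment> \<open>Since \<open>x \<ge> 1\<close>, the factor \<open>int x ^ 2\<close> can be
    cancelled.\<close>
  finally have "(\<Sum>k=0..r. coeff Q (2 * k + 2) * int x ^ (2 * k)) = 0"
    using assms by simp
  then have "real_of_int (\<Sum>k=0..r. coeff Q (2 * k + 2) * int x ^ (2 * k)) = 0" by simp
  then have "(-1) ^ (r + 1) * (\<Sum>k=0..r. real_of_int (coeff Q (2 * k + 2)) * real x ^ (2 * k)) = 0"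
    by simp
  then show ?thesis
    unfolding conv sum_distrib_left by (simp add: algebra_simps)
qed

theorem corollary5p1:
  fixes r j :: nat
  assumes "r \<ge> 1" and "j \<in> {0..r}"
  shows "(\<Sum>k=0..r.
            1 / real (2*j + 2*k + 1)
            * (\<Sum>m=0..2*j + 2*k.
                 real ((2*j + 2*k + 1) choose m)
                 * (real (r + 1) ^ (2*j + 2*k + 1 - m) - 1)
                 * (\<Sum>l=0..m. (-1) ^ l * fact l / real (l + 1) * real (Stirling m l)))
            * (\<Sum>i=0..2*k + 2.
                 (-1) ^ (r + 1 + i)
                 * of_int (signed_stirling (r + 1) i)
                 * of_int (signed_stirling (r + 1) (2*k + 2 - i)))) = 0"
proof -
  define c :: "nat \<Rightarrow> real" where "c k = (\<Sum>i=0..2*k + 2. (-1) ^ (r + 1 + i) *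
      of_int (signed_stirling (r + 1) i) * of_int (signed_stirling (r + 1) (2*k + 2 - i)))" for k
  have power_sum: "1 / real (2*j + 2*k + 1) * (\<Sum>m=0..2*j + 2*k.
      real ((2*j + 2*k + 1) choose m) * (real (r + 1) ^ (2*j + 2*k + 1 - m) - 1) * bernoulli_number m)
      = (\<Sum>x=1..r. real x ^ (2*j + 2*k))" for k
  proof -
    have "{0..2*j + 2*k} = {..<2*j + 2*k + 1}" by auto
    then show ?thesis
      using faulhaber[of "2*j + 2*k + 1" r] by (simp only:) simp
  qed
  \<comment> \<open>The factor \<open>real x ^ (2*j)\<close> is free of \<open>k\<close>, so for
    each \<open>x\<close> the sum from \<open>stirling_convolution_root\<close> remains.\<close>
  have "(\<Sum>k=0..r. (\<Sum>x=1..r. real x ^ (2*j + 2*k)) * c k) =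
      (\<Sum>x=1..r. real x ^ (2*j) * (\<Sum>k=0..r. c k * real x ^ (2*k)))"
    unfolding sum_distrib_left sum_distrib_right
    by (subst sum.swap) (simp add: power_add algebra_simps)
  also have "\<dots> = 0"
    using stirling_convolution_root unfolding c_def by (intro sum.neutral) auto
  finally show ?thesis
    unfolding bernoulli_number_def[symmetric] power_sum c_def[symmetric] .
qed

end
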